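(* Let $(v_1,\ldots,v_p)$ be a basis of a subspace $V\subset X$ and $(w_1,\ldots,w_q)$ a basis of a subspace $W\subset X$. Let $A=\big(\langle w_i,w_j\rangle\big)$ ($q\times q$), $B=\big(\langle w_i,v_j\rangle\big)$ ($q\times p$) and $D=\big(\langle v_i,v_j\rangle\big)$ ($p\times p$). Then $$\cos^2 \Theta_{V,W} = \frac{\det(\bar{B}^T A^{-1}B)}{\det D},$$ where $\bar B^T$ is the conjugate transpose of $B$ (the transpose in the real case).
   Context: $X$ is an $n$-dimensional vector space over $\mathbb{R}$ (real case) or $\mathbb{C}$ (complex case) with inner product $\langle\cdot,\cdot\rangle$ (Hermitian in the complex case, conjugate-linear in the first argument). Blades: a $p$-blade is a simple multivector $\nu=v_1\wedge\cdots\wedge v_p\in\Lambda^pX$; if $\nu\neq0$ it represents the $p$-dimensional subspace $V=\mathrm{span}(v_1,\ldots,v_p)$. Nonzero scalars in $\Lambda^0X$ are $0$-blades representing $\{0\}$. $\Lambda X$ has the inner product given on $p$-blades by $\langle v_1\wedge\cdots\wedge v_p,\,w_1\wedge\cdots\wedge w_p\rangle=\det(\langle v_i,w_j\rangle)$, extended (sesqui)linearly, with distinct grades orthogonal; $\|\nu\|=\sqrt{\langle\nu,\nu\rangle}$. Grassmann angle: for subspaces $V,W\subset X$ (of possibly different dimensions), let $P$ be the orthogonal projection of $X$ onto $W$, acting on blades by $P(v_1\wedge\cdots\wedge v_p)=Pv_1\wedge\cdots\wedge Pv_p$ (identity on scalars). The Grassmann angle $\Theta_{V,W}\in[0,\frac\pi2]$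 is defined by $\cos\Theta_{V,W}=\|P\nu\|/\|\nu\|$ for any nonzero blade $\nu$ representing $V$ (independent of $\nu$). It is not symmetric in general. *)

theory Defs
  imports
    Complex_Main
    "Jordan_Normal_Form.Conjugate"
    "Jordan_Normal_Form.Determinant"
    "Jordan_Normal_Form.Gauss_Jordan_Elimination"
    "Jordan_Normal_Form.Schur_Decomposition"
begin

section \<open>The scalar field\<close>

text \<open>
  The class has \<open>real\<close> (with trivial conjugation) and \<open>complex\<close> (with \<open>cnj\<close>) as instances.
  Lemma \<open>real_or_complex_cases\<close> shows that there are no others up to isomorphism.
\<close>

class real_or_complex = conjugatable_field + real_normed_field +
  assumes conjugate_mult_self_scaleR: "conjugate a * a = scaleR ((norm a)\<^sup>2) 1"

lemma conjugate_mult_self: "conjugate a * a = of_real ((norm a)\<^sup>2)" for a :: "'k::real_or_complex"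
  using conjugate_mult_self_scaleR[of a] by (simp add: of_real_def)

instance real :: real_or_complex
  by standard (simp add: power2_eq_square)

instance complex :: real_or_complex
  by standard (metis complex_norm_square conjugate_complex_def mult.commute of_real_def)

lemma conjugate_of_real [simp]:
  "conjugate (of_real x :: 'k::real_or_complex) = of_real x"
proof (cases "x = 0")
  case False
  have "conjugate (of_real x :: 'k) * of_real x = of_real x * of_real x"
    using conjugate_mult_self[of "of_real x :: 'k"] by (simp add: power2_eq_square)
  with False show ?thesis by simp
qed simp

lemma conjugate_one [simp]: "conjugate (1 :: 'k::real_or_complex) = 1"
  using conjugate_of_real[of 1, where 'k='k] by simp

lemma conjugate_fixed_real:
  fixes a :: "'k::real_or_complex"
  assumes "conjugate a = a"
  shows "a \<in> \<real>"
proof -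
  have "a * a = of_real (norm a) * of_real (norm a)"
    using conjugate_mult_self[of a] assms by (simp add: power2_eq_square)
  then have "a = of_real (norm a) \<or> a = - of_real (norm a)"
    by (simp add: square_eq_iff)
  then show ?thesis by (metis Reals_minus Reals_of_real)
qed

lemma real_or_complex_cases:
  "(\<forall>a::'k::real_or_complex. a \<in> \<real>) \<or>
   (\<exists>i::'k. i * i = -1 \<and> conjugate i = - i \<and> (\<forall>a. \<exists>x y. a = of_real x + of_real y * i))"
proof (cases "\<forall>a::'k. conjugate a = a")
  case True
  then show ?thesis using conjugate_fixed_real by blast
next
  case False
  then obtain c :: 'k where c: "conjugate c \<noteq> c" by blast
  define b where "b = c - conjugate c"
  have diff: "conjugate (x - y) = conjugate x - conjugate y" for x y :: 'k
    using conjugate_dist_add[of x "- y"] by (simp add: conjugate_neg)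
  have b: "b \<noteq> 0" "conjugate b = - b" using c by (auto simp: b_def diff)
  define i where "i = of_real (1 / norm b) * b"
  have ci: "conjugate i = - i" unfolding i_def conjugate_dist_mul conjugate_of_real b(2) by simp
  have ni: "norm i = 1" using b by (simp add: i_def norm_mult norm_divide)
  have "- (i * i) = 1" using conjugate_mult_self[of i] ci ni by simp
  then have ii: "i * i = -1" by (metis minus_minus)
  have "\<exists>x y. a = of_real x + of_real y * i" for a :: 'k
  proof -
    have half: "conjugate (a / 2) = conjugate a / 2" for a :: 'k
      using conjugate_dist_mul[of a "of_real (1/2)"] unfolding conjugate_of_real by simp
    have "(a + conjugate a) / 2 \<in> \<real>"
      by (rule conjugate_fixed_real) (simp add: half conjugate_dist_add add.commute)
    then obtain x where x: "(a + conjugate a) / 2 = of_real x" by (auto elim: Reals_cases)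
    have "- ((a - conjugate a) / 2 * i) \<in> \<real>"
      by (rule conjugate_fixed_real)
        (simp add: half diff conjugate_neg conjugate_dist_mul ci algebra_simps diff_divide_distrib)
    then obtain y where y: "- ((a - conjugate a) / 2 * i) = of_real y" by (auto elim: Reals_cases)
    have "of_real y * i = - ((a - conjugate a) / 2 * (i * i))"
      unfolding y[symmetric] by (simp add: mult.assoc)
    also have "\<dots> = (a - conjugate a) / 2" by (simp add: ii)
    finally have "of_real x + of_real y * i = (a + conjugate a) / 2 + (a - conjugate a) / 2"
      using x by simp
    also have "\<dots> = a" by (simp add: field_simps)
    finally show ?thesis by metis
  qed
  with ii ci show ?thesis by blast
qed


section \<open>Finite-dimensional inner product spaces and their exterior algebra\<close>

locale finite_dim_inner_product_space = vector_space scale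
  for scale :: "'k::real_or_complex \<Rightarrow> 'x::ab_group_add \<Rightarrow> 'x" (infixr \<open>*s\<close> 75) +
  fixes ip :: "'x \<Rightarrow> 'x \<Rightarrow> 'k"
  assumes finite_dim: "\<exists>S. finite S \<and> span S = UNIV"
    and ip_add_right: "ip x (y + z) = ip x y + ip x z"
    and ip_scale_right: "ip x (c *s y) = c * ip x y"
    and ip_conjugate: "ip y x = conjugate (ip x y)"
    and ip_pos: "x \<noteq> 0 \<Longrightarrow> \<exists>r>0. ip x x = of_real r"
begin

definition functional :: "('x \<Rightarrow> 'k) \<Rightarrow> bool" where
  "functional f \<longleftrightarrow> Vector_Spaces.linear scale (*) f"

text \<open>
  As \<open>X\<close> is finite-dimensional and the scalars have characteristic 0, \<open>\<Lambda>\<^sup>p X\<close> is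
  the space of alternating \<open>p\<close>-linear forms on the dual of \<open>X\<close>, where \<open>v\<^sub>1 \<and> \<dots> \<and> v\<^sub>p\<close> is
  the form \<open>(f\<^sub>1, \<dots>, f\<^sub>p) \<mapsto> det (f\<^sub>i v\<^sub>j)\<close>. A multivector is therefore represented by a function
  on lists of functionals; its values on lists of length \<open>p\<close> make up its grade \<open>p\<close> part. Lists
  containing anything but linear functionals are mapped to 0. The empty wedge is the unit scalar.
\<close>

definition wedge :: "'x list \<Rightarrow> ('x \<Rightarrow> 'k) list \<Rightarrow> 'k" where
  "wedge vs = (\<lambda>fs. if length fs = length vs \<and> (\<forall>f\<in>set fs. functional f)
     then det (mat (length vs) (length vs) (\<lambda>(i, j). (fs ! i) (vs ! j))) else 0)"

definition wedge_comb :: "('k \<times> 'x list) list \<Rightarrow> ('x \<Rightarrow> 'k) list \<Rightarrow> 'k" where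
  "wedge_comb r = (\<lambda>fs. \<Sum>(c, vs)\<leftarrow>r. c * wedge vs fs)"

definition multivectors :: "(('x \<Rightarrow> 'k) list \<Rightarrow> 'k) set" where
  "multivectors = range wedge_comb"

definition scalar_mv :: "'k \<Rightarrow> ('x \<Rightarrow> 'k) list \<Rightarrow> 'k" where
  "scalar_mv c = wedge_comb [(c, [])]"

inductive blade_represents :: "(('x \<Rightarrow> 'k) list \<Rightarrow> 'k) \<Rightarrow> 'x set \<Rightarrow> bool" where
  scalar: "c \<noteq> 0 \<Longrightarrow> blade_represents (scalar_mv c) {0}"
| wedge: "vs \<noteq> [] \<Longrightarrow> wedge vs \<noteq> (\<lambda>_. 0) \<Longrightarrow> blade_represents (wedge vs) (span (set vs))"

definition blade_ip :: "'x list \<Rightarrow> 'x list \<Rightarrow> 'k" where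
  "blade_ip vs ws = (if length vs = length ws
     then det (mat (length vs) (length vs) (\<lambda>(i, j). ip (vs ! i) (ws ! j))) else 0)"

text \<open>
  The sesquilinear extension of \<open>blade_ip\<close> to \<open>\<Lambda>X\<close>; lemma \<open>mv_ip_wedge_comb\<close> shows that it does
  not depend on how the two multivectors are written as combinations of wedges.
\<close>

definition mv_ip :: "(('x \<Rightarrow> 'k) list \<Rightarrow> 'k) \<Rightarrow> (('x \<Rightarrow> 'k) list \<Rightarrow> 'k) \<Rightarrow> 'k" where
  "mv_ip F G = (THE s. \<exists>r r'. F = wedge_comb r \<and> G = wedge_comb r' \<and>
     s = (\<Sum>(c, vs)\<leftarrow>r. \<Sum>(d, ws)\<leftarrow>r'. conjugate c * d * blade_ip vs ws))"

text \<open>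
  \<open>mv_ip F F\<close> is a nonnegative real, as an element of the scalar field; the inner \<open>norm\<close> (the
  absolute value of scalars) turns it into an element of type \<open>real\<close>.
\<close>

definition mv_norm :: "(('x \<Rightarrow> 'k) list \<Rightarrow> 'k) \<Rightarrow> real" where
  "mv_norm F = sqrt (norm (mv_ip F F))"

text \<open>
  The map of \<open>\<Lambda>X\<close> induced by a linear map \<open>T\<close> of \<open>X\<close>, i.e. the linear map with
  \<open>v\<^sub>1 \<and> \<dots> \<and> v\<^sub>p \<mapsto> T v\<^sub>1 \<and> \<dots> \<and> T v\<^sub>p\<close>; see lemmas \<open>mv_map_wedge\<close> and \<open>mv_map_scalar\<close>.
\<close>

definition mv_map :: "('x \<Rightarrow> 'x) \<Rightarrow> (('x \<Rightarrow> 'k) list \<Rightarrow> 'k) \<Rightarrow> ('x \<Rightarrow> 'k) list \<Rightarrow> 'k" where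
  "mv_map T F = (\<lambda>fs. if \<forall>f\<in>set fs. functional f then F (map (\<lambda>f. f \<circ> T) fs) else 0)"

definition orth_proj :: "'x set \<Rightarrow> 'x \<Rightarrow> 'x" where
  "orth_proj W x = (THE y. y \<in> W \<and> (\<forall>w\<in>W. ip w (x - y) = 0))"

definition grassmann_angle :: "'x set \<Rightarrow> 'x set \<Rightarrow> real" where
  "grassmann_angle V W = (THE \<theta>. 0 \<le> \<theta> \<and> \<theta> \<le> pi / 2 \<and>
     (\<forall>\<nu>. blade_represents \<nu> V \<longrightarrow> cos \<theta> = mv_norm (mv_map (orth_proj W) \<nu>) / mv_norm \<nu>))"

definition basis_list :: "'x list \<Rightarrow> 'x set \<Rightarrow> bool" where
  "basis_list vs V \<longleftrightarrow> distinct vs \<and> independent (set vs) \<and> span (set vs) = V"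


subsection \<open>Consistency of the definitions\<close>

lemma functional_ip: "functional (ip x)"
  unfolding functional_def
  by unfold_locales (auto simp: ip_add_right ip_scale_right algebra_simps)

lemma blade_ip_eq_wedge: "blade_ip vs ws = wedge ws (map ip vs)"
proof -
  have "mat n n (\<lambda>(i, j). ip (vs ! i) (ws ! j)) = mat n n (\<lambda>(i, j). (map ip vs ! i) (ws ! j))"
    if "n = length vs" for n
    using that by (intro eq_matI) auto
  then show ?thesis by (auto simp: blade_ip_def wedge_def functional_ip)
qed

lemma conjugate_sum: "conjugate (sum f A) = (\<Sum>a\<in>A. conjugate (f a :: 'k))"
  by (induction A rule: infinite_finite_induct) (auto simp: conjugate_dist_add)

lemma conjugate_prod: "conjugate (prod f A) = (\<Prod>a\<in>A. conjugate (f a :: 'k))"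
  by (induction A rule: infinite_finite_induct) (auto simp: conjugate_dist_mul)

lemma conjugate_sum_list: "conjugate (sum_list xs) = sum_list (map conjugate (xs :: 'k list))"
  by (induction xs) (auto simp: conjugate_dist_add)

lemma conjugate_det:
  fixes A :: "'k mat"
  assumes "A \<in> carrier_mat n n"
  shows "conjugate (det A) = det (map_mat conjugate A)"
proof -
  have "conjugate (signof p) = (signof p :: 'k)" for p :: "nat \<Rightarrow> nat"
    by (auto simp: sign_def conjugate_neg)
  moreover have "(\<Prod>i = 0..<n. conjugate (A $$ (i, p i))) = (\<Prod>i = 0..<n. map_mat conjugate A $$ (i, p i))"
    if "p permutes {0..<n}" for p
    using assms that by (intro prod.cong) (auto dest: permutes_in_image)
  ultimately show ?thesis
    using assms by (simp add: det_def conjugate_sum conjugate_prod conjugate_dist_mul)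
qed

lemma blade_ip_conjugate: "blade_ip ws vs = conjugate (blade_ip vs ws)"
proof (cases "length vs = length ws")
  case True
  define n where "n = length vs"
  let ?M = "mat n n (\<lambda>(i, j). ip (vs ! i) (ws ! j))"
  have "conjugate (det ?M) = det (map_mat conjugate ?M)" by (rule conjugate_det[of _ n]) simp
  also have "\<dots> = det (transpose_mat (map_mat conjugate ?M))"
    by (rule det_transpose[symmetric]) auto
  also have "transpose_mat (map_mat conjugate ?M) = mat n n (\<lambda>(i, j). ip (ws ! i) (vs ! j))"
    by (rule eq_matI) (auto simp: ip_conjugate[symmetric])
  finally show ?thesis using True by (simp add: blade_ip_def n_def)
qed (simp add: blade_ip_def)

lemma mv_ip_aux:
  "(\<Sum>(c, vs)\<leftarrow>r. \<Sum>(d, ws)\<leftarrow>r'. conjugate c * d * blade_ip vs ws) =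
   (\<Sum>(c, vs)\<leftarrow>r. conjugate c * wedge_comb r' (map ip vs))"
  by (simp add: wedge_comb_def blade_ip_eq_wedge sum_list_const_mult[symmetric]
      case_prod_unfold mult.assoc)

lemma mv_ip_aux':
  "(\<Sum>(c, vs)\<leftarrow>r. conjugate c * wedge_comb r' (map ip vs)) =
   conjugate (\<Sum>(d, ws)\<leftarrow>r'. conjugate d * wedge_comb r (map ip ws))"
proof -
  have "(\<Sum>(c, vs)\<leftarrow>r. \<Sum>(d, ws)\<leftarrow>r'. conjugate c * d * blade_ip vs ws) =
    (\<Sum>(d, ws)\<leftarrow>r'. \<Sum>(c, vs)\<leftarrow>r. conjugate c * d * blade_ip vs ws)"
    by (induction r) (auto simp: sum_list_addf case_prod_unfold)
  also have "\<dots> = conjugate (\<Sum>(d, ws)\<leftarrow>r'. \<Sum>(c, vs)\<leftarrow>r. conjugate d * c * blade_ip ws vs)"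
    by (simp add: conjugate_sum_list o_def case_prod_unfold conjugate_dist_mul
        blade_ip_conjugate[symmetric] ac_simps)
  finally show ?thesis by (simp only: mv_ip_aux)
qed

lemma mv_ip_wedge_comb:
  "mv_ip (wedge_comb r) (wedge_comb r') =
   (\<Sum>(c, vs)\<leftarrow>r. \<Sum>(d, ws)\<leftarrow>r'. conjugate c * d * blade_ip vs ws)"
  unfolding mv_ip_def mv_ip_aux
  by (rule the_equality, blast) (metis mv_ip_aux')

lemma wedge_comb_single: "wedge_comb [(1, vs)] = wedge vs"
  by (simp add: wedge_comb_def)

lemma mv_ip_wedge: "mv_ip (wedge vs) (wedge ws) = blade_ip vs ws"
  using mv_ip_wedge_comb[of "[(1, vs)]" "[(1, ws)]"] by (simp add: wedge_comb_single)

lemma mv_ip_scalar: "mv_ip (scalar_mv c) (scalar_mv d) = conjugate c * d"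
  using mv_ip_wedge_comb[of "[(c, [])]" "[(d, [])]"]
  by (simp add: scalar_mv_def blade_ip_def)

lemma mv_map_wedge:
  assumes "Vector_Spaces.linear scale scale T"
  shows "mv_map T (wedge vs) = wedge (map T vs)"
proof
  fix fs
  have lin: "functional (f \<circ> T)" if "functional f" for f
    using Vector_Spaces.linear_compose[OF assms] that by (simp add: functional_def)
  show "mv_map T (wedge vs) fs = wedge (map T vs) fs"
  proof (cases "length fs = length vs \<and> (\<forall>f\<in>set fs. functional f)")
    case True
    then have "mat (length vs) (length vs) (\<lambda>(i, j). (map (\<lambda>f. f \<circ> T) fs ! i) (vs ! j)) =
      mat (length vs) (length vs) (\<lambda>(i, j). (fs ! i) (map T vs ! j))"
      by (intro eq_matI) auto
    with True lin show ?thesis by (simp add: mv_map_def wedge_def)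
  qed (auto simp: mv_map_def wedge_def)
qed

lemma mv_map_scalar: "mv_map T (scalar_mv c) = scalar_mv c"
  by (auto simp: mv_map_def scalar_mv_def wedge_comb_def wedge_def fun_eq_iff)

end

end

(* The squared norm of a blade is the Gram determinant of its factors. By induction on the factors
   it is a product of squared distances, hence a nonnegative real, and it does not increase under a
   linear contraction such as the orthogonal projection P onto W: so the ratio |P v| / |v| lies in
   [0, 1] and is a cosine. A change of basis multiplies the Gram determinants of the v_j and of the
   P v_j by the same factor |det C|^2, so the ratio depends on V only. *)

theory Submission
  imports Defs
begin

section \<open>Adjoints and inverses of matrices\<close>

lemma dim_mat_adjoint [simp]:
  "dim_row (mat_adjoint A) = dim_col A" "dim_col (mat_adjoint A) = dim_row A"
  by (auto simp: mat_adjoint_def)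

lemma index_mat_adjoint [simp]:
  "i < dim_col A \<Longrightarrow> j < dim_row A \<Longrightarrow> mat_adjoint A $$ (i, j) = conjugate (A $$ (j, i))"
  by (simp add: mat_adjoint_def mat_of_rows_index)

lemma mat_adjoint_carrier [simp]: "A \<in> carrier_mat m n \<Longrightarrow> mat_adjoint A \<in> carrier_mat n m"
  by (auto intro: carrier_matI)

text \<open>\<open>mat_inverse\<close> yields \<open>None\<close> only for a matrix that is not a
  unit, and a nonzero determinant makes \<open>A\<close> a unit over a field.\<close>

lemma mat_inverse_det_nonzero:
  fixes A :: "'a::field mat"
  assumes "A \<in> carrier_mat n n" "det A \<noteq> 0"
  shows "the (mat_inverse A) \<in> carrier_mat n n" "the (mat_inverse A) * A = 1\<^sub>m n"
  using mat_inverse(2)[OF assms(1)] mat_inverse(1)[OF assms(1)] det_non_zero_imp_unit[OF assms]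
  by (cases "mat_inverse A"; force)+

context finite_dim_inner_product_space
begin

lemma mat_adjoint_mult:
  fixes A B :: "'k mat"
  assumes "dim_col A = dim_row B"
  shows "mat_adjoint (A * B) = mat_adjoint B * mat_adjoint A"
  using assms by (intro eq_matI)
    (auto simp: scalar_prod_def conjugate_sum conjugate_dist_mul mult.commute intro!: sum.cong)

lemma det_mat_adjoint:
  fixes A :: "'k mat"
  assumes "A \<in> carrier_mat n n"
  shows "det (mat_adjoint A) = conjugate (det A)"
proof -
  have "mat_adjoint A = transpose_mat (map_mat conjugate A)"
    by (rule eq_matI) auto
  then show ?thesis
    using assms det_transpose[of "map_mat conjugate A" n] by (simp add: conjugate_det)
qed

section \<open>Sesquilinearity and squared norms\<close>

lemma ip_zero_right [simp]: "ip x 0 = 0"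
  using ip_add_right[of x 0 0] by simp

lemma ip_zero_left [simp]: "ip 0 x = 0"
  using ip_conjugate[of 0 x] by simp

lemma ip_add_left: "ip (x + y) z = ip x z + ip y z"
  using ip_conjugate[of _ z] by (metis ip_add_right conjugate_dist_add)

lemma ip_scale_left: "ip (c *s x) z = conjugate c * ip x z"
  using ip_conjugate[of _ z] by (metis ip_scale_right conjugate_dist_mul)

lemma ip_diff_right: "ip x (y - z) = ip x y - ip x z"
  using ip_add_right[of x "y - z" z] by (simp add: eq_diff_eq)

lemma ip_sum_right: "ip x (sum f A) = (\<Sum>a\<in>A. ip x (f a))"
  by (induction A rule: infinite_finite_induct) (auto simp: ip_add_right)

lemma ip_eq_zero_commute: "ip x y = 0 \<longleftrightarrow> ip y x = 0"
  by (metis ip_conjugate conjugate_zero_iff)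

text \<open>Real-valued so that distances can be compared; \<open>ip x x\<close> itself lies in the
  scalar field.\<close>

definition nsq :: "'x \<Rightarrow> real" where
  "nsq x = norm (ip x x)"

lemma nsq_nonneg [simp]: "0 \<le> nsq x"
  by (simp add: nsq_def)

lemma ip_self: "ip x x = of_real (nsq x)"
  by (cases "x = 0") (use ip_pos[of x] in \<open>auto simp: nsq_def\<close>)

lemma ip_self_eq_0_iff [simp]: "ip x x = 0 \<longleftrightarrow> x = 0"
  using ip_pos[of x] by fastforce

text \<open>Pythagoras: by conjugate symmetry both cross terms vanish. The identity is obtained in
  the scalar field and pulled back along the injective \<open>of_real\<close>.\<close>

lemma nsq_add:
  assumes "ip x y = 0"
  shows "nsq (x + y) = nsq x + nsq y"
proof -
  have "of_real (nsq (x + y)) = (of_real (nsq x + nsq y) :: 'k)"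
    using assms ip_eq_zero_commute[of x y] by (simp add: ip_self[symmetric] ip_add_left ip_add_right)
  then show ?thesis by (simp only: of_real_eq_iff)
qed

section \<open>Orthogonal projection onto the span of a finite set\<close>

lemma orthogonal_span:
  assumes "\<forall>s\<in>S. ip s x = 0" "w \<in> span S"
  shows "ip w x = 0"
  using assms(2) by (induction rule: span_induct_alt) (auto simp: assms(1) ip_add_left ip_scale_left)

text \<open>Gram-Schmidt by induction on \<open>S\<close>: a new vector \<open>a\<close> matters
  only through its component \<open>c\<close> orthogonal to \<open>span S\<close>, and the
  projection \<open>y\<close> of \<open>x\<close> to \<open>span S\<close> is corrected along
  \<open>c\<close>.\<close>

lemma orthogonal_decomposition:
  assumes "finite S"
  shows "\<exists>y\<in>span S. \<forall>w\<in>span S. ip w (x - y) = 0"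
  using assms
proof (induction arbitrary: x)
  case (insert a S)
  obtain b where b: "b \<in> span S" "\<forall>w\<in>span S. ip w (a - b) = 0" using insert.IH by blast
  obtain y where y: "y \<in> span S" "\<forall>w\<in>span S. ip w (x - y) = 0" using insert.IH by blast
  define c where "c = a - b"
  \<comment> \<open>The correction is the projection of \<open>x\<close> onto the line through
    \<open>c\<close>; it is 0 when \<open>a\<close> already lies in \<open>span S\<close>.\<close>
  define z where "z = y + (ip c x / ip c c) *s c"
  have S: "ip s (x - z) = 0" if "s \<in> span S" for s
    using that y(2) b(2) by (simp add: z_def c_def ip_diff_right ip_add_right ip_scale_right)
  have "ip y c = 0" using y(1) b(2) by (simp add: c_def)
  then have "ip c y = 0" using ip_eq_zero_commute by blast
  then have "ip c (x - z) = 0"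
    by (cases "c = 0") (simp_all add: z_def ip_diff_right ip_add_right ip_scale_right)
  moreover have "a = c + b" by (simp add: c_def)
  ultimately have a: "ip a (x - z) = 0" using S[OF b(1)] by (simp add: ip_add_left)
  have "c \<in> span (insert a S)" "y \<in> span (insert a S)"
    using b(1) y(1) span_mono[of S "insert a S"]
    by (auto simp: c_def intro!: span_diff intro: span_base)
  then have "z \<in> span (insert a S)" by (auto simp: z_def intro: span_add span_scale)
  moreover have "ip w (x - z) = 0" if "w \<in> span (insert a S)" for w
    by (rule orthogonal_span[OF _ that]) (auto simp: a S span_base)
  ultimately show ?case by blast
qed auto

text \<open>Uniqueness: the difference of two candidates lies in the span and is orthogonal to
  itself, hence is 0.\<close>

lemma orth_proj_eqI:
  assumes "y \<in> span S" "\<forall>w\<in>span S. ip w (x - y) = 0"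
  shows "orth_proj (span S) x = y"
  unfolding orth_proj_def
proof (rule the_equality)
  fix z assume z: "z \<in> span S \<and> (\<forall>w\<in>span S. ip w (x - z) = 0)"
  then have m: "y - z \<in> span S" using assms span_diff by blast
  have "ip (y - z) ((x - z) - (x - y)) = 0"
    using m assms z by (simp only: ip_diff_right) simp
  then show "z = y" by simp
qed (use assms in blast)

lemma
  assumes "finite S"
  shows orth_proj_in_span: "orth_proj (span S) x \<in> span S"
    and orth_proj_orthogonal: "w \<in> span S \<Longrightarrow> ip w (x - orth_proj (span S) x) = 0"
  using orthogonal_decomposition[OF assms, of x] orth_proj_eqI[of _ S x] by auto

lemma orth_proj_linear:
  assumes "finite S"
  shows "Vector_Spaces.linear scale scale (orth_proj (span S))"
proof unfold_locales
  note P = orth_proj_in_span[OF assms] orth_proj_orthogonal[OF assms]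
  fix x y c
  show "orth_proj (span S) (x + y) = orth_proj (span S) x + orth_proj (span S) y"
    using P(2)[of _ x] P(2)[of _ y]
    by (intro orth_proj_eqI) (auto intro: P span_add simp: ip_diff_right ip_add_right)
  show "orth_proj (span S) (c *s x) = c *s orth_proj (span S) x"
    using P(2)[of _ x]
    by (intro orth_proj_eqI) (auto intro: P span_scale simp: ip_diff_right ip_scale_right)
qed

lemma nsq_orth_proj_le:
  assumes "finite S"
  shows "nsq (orth_proj (span S) x) \<le> nsq x"
  using nsq_add[OF orth_proj_orthogonal[OF assms orth_proj_in_span[OF assms]], of x x] by simp

text \<open>Pythagoras for \<open>x - w = (?p - w) + (x - ?p)\<close>, where \<open>?p\<close> is
  the projection of \<open>x\<close>.\<close>

lemma orth_proj_nearest: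
  assumes "finite S" "w \<in> span S"
  shows "nsq (x - orth_proj (span S) x) \<le> nsq (x - w)"
proof -
  let ?p = "orth_proj (span S) x"
  have "ip (?p - w) (x - ?p) = 0"
    using assms orth_proj_in_span orth_proj_orthogonal span_diff by blast
  from nsq_add[OF this] show ?thesis by simp
qed

section \<open>Coordinates with respect to a list of vectors\<close>

text \<open>Coefficients are indexed by position in the list, so that they can later form the
  columns of a matrix.\<close>

lemma span_set_iff: "x \<in> span (set xs) \<longleftrightarrow> (\<exists>c. x = (\<Sum>i<length xs. c i *s xs ! i))"
proof (induction xs arbitrary: x)
  case (Cons a xs)
  show ?case
  proof
    assume "x \<in> span (set (a # xs))"
    then obtain k c where "x - k *s a = (\<Sum>i<length xs. c i *s xs ! i)"
      using Cons by (auto simp: span_breakdown_eq)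
    \<comment> \<open>\<open>case_nat k c\<close> puts the coefficient \<open>k\<close> of
      \<open>a\<close> in front of those given by \<open>c\<close>.\<close>
    then have "x = (\<Sum>i<length (a # xs). case_nat k c i *s (a # xs) ! i)"
      by (simp add: sum.lessThan_Suc_shift algebra_simps del: sum.lessThan_Suc)
    then show "\<exists>c. x = (\<Sum>i<length (a # xs). c i *s (a # xs) ! i)" by blast
  next
    assume "\<exists>c. x = (\<Sum>i<length (a # xs). c i *s (a # xs) ! i)"
    then show "x \<in> span (set (a # xs))"
      by (elim exE, hypsubst) (intro span_sum span_scale span_base nth_mem, simp)
  qed
qed auto

text \<open>A repeated entry is itself a nontrivial relation between positions, hence
  \<open>distinct\<close> on the left. In the induction both sides reduce to the claim for
  \<open>xs\<close> together with \<open>a\<close> lying outside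
  \<open>span (set xs)\<close>.\<close>

lemma independent_list_iff:
  "distinct xs \<and> independent (set xs) \<longleftrightarrow>
   (\<forall>c. (\<Sum>i<length xs. c i *s xs ! i) = 0 \<longrightarrow> (\<forall>i<length xs. c i = 0))"
proof (induction xs)
  case (Cons a xs)
  have *: "distinct (a # xs) \<and> independent (set (a # xs)) \<longleftrightarrow>
      a \<notin> span (set xs) \<and> distinct xs \<and> independent (set xs)"
    by (auto simp: independent_insert span_base)
  show ?case (is "_ = ?R")
  proof
    assume "distinct (a # xs) \<and> independent (set (a # xs))"
    then have a: "a \<notin> span (set xs)"
      and IH: "\<And>c. (\<Sum>i<length xs. c i *s xs ! i) = 0 \<Longrightarrow> \<forall>i<length xs. c i = 0"
      using Cons * by auto
    show ?R
    proof safe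
      fix c i
      assume "(\<Sum>i<length (a # xs). c i *s (a # xs) ! i) = 0" and i: "i < length (a # xs)"
      then have s: "c 0 *s a + (\<Sum>i<length xs. c (Suc i) *s xs ! i) = 0"
        by (simp add: sum.lessThan_Suc_shift del: sum.lessThan_Suc)
      have "(\<Sum>i<length xs. c (Suc i) *s xs ! i) \<in> span (set xs)"
        by (auto simp: span_set_iff)
      with s have "c 0 *s a \<in> span (set xs)"
        by (metis add.inverse_inverse add_eq_0_iff span_neg)
      with a have "c 0 = 0" by (metis span_scale scale_scale scale_one left_inverse)
      with s IH[of "\<lambda>i. c (Suc i)"] i show "c i = 0" by (cases i) auto
    qed
  next
    assume R: ?R
    have "a \<notin> span (set xs)"
    proof
      assume "a \<in> span (set xs)"
      then obtain c where "a = (\<Sum>i<length xs. c i *s xs ! i)" by (auto simp: span_set_iff)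
      then have "(\<Sum>i<length (a # xs). case_nat (-1) c i *s (a # xs) ! i) = 0"
        by (simp add: sum.lessThan_Suc_shift del: sum.lessThan_Suc)
      from R[rule_format, OF this, of 0] show False by simp
    qed
    moreover have "\<forall>i<length xs. c i = 0" if "(\<Sum>i<length xs. c i *s xs ! i) = 0" for c
    proof -
      from that have "(\<Sum>i<length (a # xs). case_nat 0 c i *s (a # xs) ! i) = 0"
        by (simp add: sum.lessThan_Suc_shift del: sum.lessThan_Suc)
      from R[rule_format, OF this, of "Suc _"] show ?thesis by simp
    qed
    ultimately show "distinct (a # xs) \<and> independent (set (a # xs))" using Cons * by blast
  qed
qed (auto simp: independent_empty)

section \<open>Gram matrices under a change of vectors\<close>

text \<open>The matrices \<open>A\<close>, \<open>B\<close> and \<open>D\<close> of the theorem are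
  \<open>gram ws ws\<close>, \<open>gram ws vs\<close> and \<open>gram vs vs\<close>.\<close>

definition gram :: "'x list \<Rightarrow> 'x list \<Rightarrow> 'k mat" where
  "gram xs ys = mat (length xs) (length ys) (\<lambda>(i, j). ip (xs ! i) (ys ! j))"

text \<open>The row of vectors \<open>xs\<close> times the matrix \<open>C\<close>; passing to new
  vectors thereby becomes matrix multiplication on Gram matrices.\<close>

definition combs :: "'x list \<Rightarrow> 'k mat \<Rightarrow> 'x list" where
  "combs xs C = map (\<lambda>j. \<Sum>i<length xs. C $$ (i, j) *s xs ! i) [0..<dim_col C]"

lemma length_combs [simp]: "length (combs xs C) = dim_col C"
  by (simp add: combs_def)

lemma gram_carrier [simp]: "gram xs ys \<in> carrier_mat (length xs) (length ys)"
  by (simp add: gram_def)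

lemma dim_gram [simp]: "dim_row (gram xs ys) = length xs" "dim_col (gram xs ys) = length ys"
  by (simp_all add: gram_def)

lemma index_gram [simp]:
  "i < length xs \<Longrightarrow> j < length ys \<Longrightarrow> gram xs ys $$ (i, j) = ip (xs ! i) (ys ! j)"
  by (simp add: gram_def)

lemma blade_ip_self: "blade_ip xs xs = det (gram xs xs)"
  by (simp add: blade_ip_def gram_def)

lemma mat_adjoint_gram: "mat_adjoint (gram xs ys) = gram ys xs"
  by (rule eq_matI) (auto simp: ip_conjugate[symmetric])

lemma gram_combs_right:
  assumes "dim_row C = length ys"
  shows "gram xs (combs ys C) = gram xs ys * C"
  using assms by (intro eq_matI)
    (auto simp: combs_def scalar_prod_def ip_sum_right ip_scale_right mult.commute
      atLeast0LessThan intro!: sum.cong)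

text \<open>Follows from \<open>gram_combs_right\<close> by taking adjoints, which swap the two
  lists of a Gram matrix.\<close>

lemma gram_combs_left:
  assumes "dim_row C = length xs"
  shows "gram (combs xs C) ys = mat_adjoint C * gram xs ys"
proof -
  have "mat_adjoint (gram ys (combs xs C)) = mat_adjoint C * mat_adjoint (gram ys xs)"
    using assms by (simp add: gram_combs_right mat_adjoint_mult)
  then show ?thesis by (simp only: mat_adjoint_gram)
qed

lemma gram_combs:
  assumes "dim_row C = length xs"
  shows "gram (combs xs C) (combs xs C) = mat_adjoint C * gram xs xs * C"
  by (simp add: gram_combs_left[OF assms] gram_combs_right[OF assms])

text \<open>The Gram matrix changes by the congruence with \<open>C\<close>, whose two outer
  determinants multiply to \<open>conjugate (det C) * det C\<close>.\<close>

lemma det_gram_combs: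
  assumes "C \<in> carrier_mat (length xs) (length xs)"
  shows "det (gram (combs xs C) (combs xs C)) = of_real ((norm (det C))\<^sup>2) * det (gram xs xs)"
proof -
  have "det (gram (combs xs C) (combs xs C)) = conjugate (det C) * det (gram xs xs) * det C"
    using assms det_mat_adjoint[OF assms] mult_carrier_mat[OF mat_adjoint_carrier[OF assms] gram_carrier]
    by (simp add: gram_combs det_mult[OF _ assms] det_mult[OF mat_adjoint_carrier[OF assms] gram_carrier])
  then show ?thesis by (simp only: conjugate_mult_self[symmetric] mult.assoc mult.left_commute mult.commute)
qed

lemma exists_combs:
  assumes "set ys \<subseteq> span (set xs)"
  shows "\<exists>C\<in>carrier_mat (length xs) (length ys). ys = combs xs C"
proof -
  have "\<forall>j<length ys. \<exists>c. ys ! j = (\<Sum>i<length xs. c i *s xs ! i)"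
    using assms by (simp only: span_set_iff[symmetric]) auto
  then obtain c where c: "\<forall>j<length ys. ys ! j = (\<Sum>i<length xs. c j i *s xs ! i)" by metis
  have "ys = combs xs (mat (length xs) (length ys) (\<lambda>(i, j). c j i))"
    by (rule nth_equalityI) (auto simp: combs_def c)
  then show ?thesis by (intro bexI) auto
qed

lemma map_linear_combs:
  assumes "Vector_Spaces.linear scale scale T" "dim_row C = length xs"
  shows "map T (combs xs C) = combs (map T xs) C"
proof -
  interpret T: Vector_Spaces.linear scale scale T by fact
  show ?thesis by (simp add: combs_def T.sum T.scale)
qed

section \<open>Independence and nonvanishing determinants\<close>

text \<open>A kernel vector of the Gram matrix is the coordinate vector of some \<open>x\<close> in
  the span that is orthogonal to all of \<open>xs\<close>, hence to itself; so \<open>x = 0\<close>,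
  against independence.\<close>

lemma det_gram_nonzero:
  assumes "distinct xs" "independent (set xs)"
  shows "det (gram xs xs) \<noteq> 0"
proof
  assume "det (gram xs xs) = 0"
  then obtain v where v: "v \<in> carrier_vec (length xs)" "v \<noteq> 0\<^sub>v (length xs)"
    "gram xs xs *\<^sub>v v = 0\<^sub>v (length xs)"
    using det_0_iff_vec_prod_zero[OF gram_carrier] by blast
  define x where "x = (\<Sum>i<length xs. v $ i *s xs ! i)"
  have "ip (xs ! i) x = (gram xs xs *\<^sub>v v) $ i" if "i < length xs" for i
    using that v(1) by (simp add: x_def ip_sum_right ip_scale_right scalar_prod_def
        atLeast0LessThan mult.commute)
  then have "\<forall>s\<in>set xs. ip s x = 0" using v(3) by (auto simp: in_set_conv_nth)
  moreover have "x \<in> span (set xs)" by (auto simp: x_def span_set_iff)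
  ultimately have "ip x x = 0" by (rule orthogonal_span)
  then have "\<forall>i<length xs. v $ i = 0"
    using assms independent_list_iff[of xs] by (simp add: x_def)
  with v(1,2) show False by auto
qed

text \<open>A linear relation between the vectors is one between the columns of every matrix of
  values of functionals, and some such matrix has nonzero determinant.\<close>

lemma wedge_nonzero_independent:
  assumes "wedge xs \<noteq> (\<lambda>_. 0)"
  shows "distinct xs \<and> independent (set xs)"
  unfolding independent_list_iff
proof safe
  fix c i
  assume c: "(\<Sum>i<length xs. c i *s xs ! i) = 0" and i: "i < length xs"
  obtain fs where fs: "length fs = length xs" "\<forall>f\<in>set fs. functional f"
    and det: "det (mat (length xs) (length xs) (\<lambda>(i, j). (fs ! i) (xs ! j))) \<noteq> 0"
    using assms by (force simp: wedge_def fun_eq_iff split: if_splits)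
  let ?n = "length xs" and ?A = "mat (length xs) (length xs) (\<lambda>(i, j). (fs ! i) (xs ! j))"
  have "?A *\<^sub>v vec ?n c = 0\<^sub>v ?n"
  proof (rule eq_vecI)
    fix k assume k: "k < dim_vec (0\<^sub>v ?n)"
    then interpret f: Vector_Spaces.linear scale "(*)" "fs ! k"
      using fs by (auto simp: functional_def)
    have "(?A *\<^sub>v vec ?n c) $ k = (fs ! k) (\<Sum>i<?n. c i *s xs ! i)"
      using k by (simp add: scalar_prod_def f.sum f.scale atLeast0LessThan mult.commute)
    then show "(?A *\<^sub>v vec ?n c) $ k = 0\<^sub>v ?n $ k" using k by (simp add: c)
  qed auto
  then have "vec ?n c = 0\<^sub>v ?n"
    using det det_0_iff_vec_prod_zero[of ?A ?n] vec_carrier[where n = ?n and f = c]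
    by (metis mat_carrier)
  then show "c i = 0" using i by (metis index_vec index_zero_vec(1))
qed

section \<open>Gram determinants as products of squared distances\<close>

text \<open>Orthogonality clears the first column below its top entry, so the Laplace expansion
  along it has a single term.\<close>

lemma det_gram_Cons_orthogonal:
  assumes "\<forall>x\<in>set xs. ip x v = 0"
  shows "det (gram (v # xs) (v # xs)) = of_real (nsq v) * det (gram xs xs)"
proof -
  let ?G = "gram (v # xs) (v # xs)"
  have "?G $$ (Suc i, 0) = 0" if "i < length xs" for i
    using that assms by simp
  then have "det ?G = ?G $$ (0, 0) * cofactor ?G 0 0"
    by (subst laplace_expansion_column[of _ "Suc (length xs)" 0])
      (auto simp: sum.lessThan_Suc_shift gram_def simp del: sum.lessThan_Suc)
  moreover have "mat_delete ?G 0 0 = gram xs xs"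
    by (rule eq_matI) (auto simp: mat_delete_def)
  ultimately show ?thesis by (simp add: cofactor_def ip_self)
qed

text \<open>Replacing \<open>v\<close> by its component orthogonal to \<open>xs\<close> is a unitriangular change of coordinates.\<close>

lemma det_gram_Cons:
  "det (gram (v # xs) (v # xs)) =
   of_real (nsq (v - orth_proj (span (set xs)) v)) * det (gram xs xs)"
proof -
  let ?n = "length xs" and ?u = "orth_proj (span (set xs)) v"
  have u: "?u \<in> span (set xs)" "\<And>w. w \<in> span (set xs) \<Longrightarrow> ip w (v - ?u) = 0"
    by (simp_all add: orth_proj_in_span orth_proj_orthogonal)
  obtain c where c: "?u = (\<Sum>i<?n. c i *s xs ! i)" using u(1) by (auto simp: span_set_iff)
  \<comment> \<open>Column 0 holds the coordinates of \<open>v - ?u\<close> with respect to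
    \<open>v # xs\<close>; the other columns are unit vectors. The shift \<open>i - 1\<close> occurs
    because \<open>xs ! i\<close> sits at position \<open>Suc i\<close> of
    \<open>v # xs\<close>.\<close>
  define C where "C = mat (Suc ?n) (Suc ?n)
    (\<lambda>(i, j). if i = j then 1 else if j = 0 then - c (i - 1) else 0)"
  have C: "C \<in> carrier_mat (Suc ?n) (Suc ?n)" by (simp add: C_def)
  have "det C = prod_list (diag_mat C)"
    by (rule det_lower_triangular[OF _ C]) (auto simp: C_def)
  also have "diag_mat C = map (\<lambda>_. 1) [0..<Suc ?n]" by (auto simp: diag_mat_def C_def)
  finally have det: "det C = 1" by (simp add: map_replicate_const del: upt_Suc)
  have "(v - ?u) # xs = combs (v # xs) C"
  proof (rule nth_equalityI)
    fix j assume j: "j < length ((v - ?u) # xs)"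
    show "((v - ?u) # xs) ! j = combs (v # xs) C ! j"
    proof (cases j)
      case 0
      then show ?thesis
        by (simp add: combs_def C_def c sum.lessThan_Suc_shift sum_negf
            del: sum.lessThan_Suc upt_Suc)
    next
      case (Suc k)
      have "(\<Sum>i<?n. C $$ (Suc i, j) *s xs ! i) = (\<Sum>i<?n. if i = k then xs ! i else 0)"
        using Suc j by (intro sum.cong) (auto simp: C_def)
      with Suc j show ?thesis
        by (simp add: combs_def C_def sum.lessThan_Suc_shift
            del: sum.lessThan_Suc upt_Suc)
    qed
  qed (simp add: C_def)
  then have "det (gram ((v - ?u) # xs) ((v - ?u) # xs)) = det (gram (v # xs) (v # xs))"
    using det_gram_combs[of C "v # xs"] C by (simp add: det)
  then show ?thesis using det_gram_Cons_orthogonal[of xs "v - ?u"] u(2) by (simp add: span_base)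
qed

text \<open>By \<open>det_gram_Cons\<close> each new vector multiplies the two determinants by
  squared distances to spans, and \<open>T\<close> does not increase these distances.\<close>

lemma det_gram_contraction:
  assumes lin: "Vector_Spaces.linear scale scale T" and le: "\<And>x. nsq (T x) \<le> nsq x"
  shows "\<exists>a b. det (gram xs xs) = of_real a \<and> det (gram (map T xs) (map T xs)) = of_real b \<and>
    0 \<le> b \<and> b \<le> a"
proof (induction xs)
  case Nil
  show ?case by (intro exI[of _ 1]) (simp add: gram_def)
next
  case (Cons v xs)
  interpret T: Vector_Spaces.linear scale scale T by fact
  let ?u = "orth_proj (span (set xs)) v" and ?t = "orth_proj (span (set (map T xs))) (T v)"
  obtain a b where ab: "det (gram xs xs) = of_real a"
    "det (gram (map T xs) (map T xs)) = of_real b" "0 \<le> b" "b \<le> a"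
    using Cons by blast
  have "?u \<in> span (set xs)" by (simp add: orth_proj_in_span)
  then have "T ?u \<in> span (set (map T xs))" by (simp add: T.span_image)
  \<comment> \<open>\<open>T ?u\<close> competes with the nearest point \<open>?t\<close> to
    \<open>T v\<close>.\<close>
  then have "nsq (T v - ?t) \<le> nsq (T v - T ?u)" by (intro orth_proj_nearest) auto
  also have "\<dots> \<le> nsq (v - ?u)" using le[of "v - ?u"] by (simp add: T.diff)
  finally have "nsq (T v - ?t) * b \<le> nsq (v - ?u) * a" using ab by (intro mult_mono) auto
  with ab show ?case
    by (intro exI[of _ "nsq (v - ?u) * a"] exI[of _ "nsq (T v - ?t) * b"])
      (simp add: det_gram_Cons)
qed

section \<open>Blade norms and the Grassmann angle\<close>

lemma mv_norm_wedge: "mv_norm (wedge xs) = sqrt (norm (det (gram xs xs)))"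
  by (simp add: mv_norm_def mv_ip_wedge blade_ip_self)

text \<open>Evaluated at the functionals \<open>ip v\<close> for \<open>v\<close> in
  \<open>vs\<close>, the wedge gives the nonzero Gram determinant.\<close>

lemma wedge_nonzero:
  assumes "basis_list vs V"
  shows "wedge vs \<noteq> (\<lambda>_. 0)"
  using assms det_gram_nonzero[of vs] blade_ip_eq_wedge[of vs vs]
  by (auto simp: basis_list_def blade_ip_self)

text \<open>Independence of the blade: the factor \<open>(norm (det C))\<^sup>2\<close> of a change
  of basis appears in numerator and denominator and cancels.\<close>

lemma blade_norm_ratio:
  assumes T: "Vector_Spaces.linear scale scale T" and vs: "basis_list vs V"
    and \<nu>: "blade_represents \<nu> V"
  shows "mv_norm (mv_map T \<nu>) / mv_norm \<nu> =
    sqrt (norm (det (gram (map T vs) (map T vs))) / norm (det (gram vs vs)))"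
  using \<nu>
proof cases
  \<comment> \<open>Here \<open>V = {0}\<close> forces \<open>vs = []\<close>, so both Gram
    determinants are empty and equal 1, while the induced map fixes scalars.\<close>
  case (scalar c)
  have "0 \<notin> set vs" using vs dependent_zero by (auto simp: basis_list_def)
  moreover have "set vs \<subseteq> {0}" using vs scalar span_superset by (auto simp: basis_list_def)
  ultimately have "vs = []" by (cases vs) auto
  with scalar show ?thesis
    by (simp add: mv_map_scalar mv_norm_def mv_ip_scalar gram_def norm_mult)
next
  case (wedge us)
  have us: "distinct us" "independent (set us)" using wedge_nonzero_independent wedge by auto
  \<comment> \<open>Bases of the same subspace have equal size, which makes \<open>C\<close>
    square.\<close>
  have "card (set us) = card (set vs)"
    using bij_if_span_eq_span_bases[of "set us" "set vs"] us vs wedge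
    by (auto simp: basis_list_def intro: bij_betw_same_card)
  then have len: "length us = length vs"
    using us vs by (auto simp: basis_list_def distinct_card)
  have "set us \<subseteq> span (set vs)" using vs wedge span_superset by (auto simp: basis_list_def)
  then obtain C where C: "C \<in> carrier_mat (length vs) (length vs)" "us = combs vs C"
    using exists_combs len by metis
  have g: "det (gram us us) = of_real ((norm (det C))\<^sup>2) * det (gram vs vs)"
    using det_gram_combs C by simp
  have h: "det (gram (map T us) (map T us)) =
      of_real ((norm (det C))\<^sup>2) * det (gram (map T vs) (map T vs))"
    using det_gram_combs[of C "map T vs"] C map_linear_combs[OF T, of C vs] by simp
  have "norm (det C) \<noteq> 0" using g det_gram_nonzero[OF us] by auto
  with wedge show ?thesis
    by (simp add: mv_map_wedge[OF T] mv_norm_wedge g h norm_mult real_sqrt_divide[symmetric])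
qed

lemma cos_grassmann_angle:
  assumes vs: "basis_list vs V" and W: "W = span S" "finite S"
  shows "of_real ((cos (grassmann_angle V W))\<^sup>2) =
    det (gram (map (orth_proj W) vs) (map (orth_proj W) vs)) / det (gram vs vs)"
proof -
  let ?T = "orth_proj W"
  have T: "Vector_Spaces.linear scale scale ?T" using orth_proj_linear W by blast
  obtain a b where ab: "det (gram vs vs) = of_real a"
    "det (gram (map ?T vs) (map ?T vs)) = of_real b" "0 \<le> b" "b \<le> a"
    using det_gram_contraction[OF T] nsq_orth_proj_le W by metis
  have "det (gram vs vs) \<noteq> 0" using vs det_gram_nonzero by (auto simp: basis_list_def)
  with ab have a: "0 < a" by auto
  define r where "r = sqrt (b / a)"
  have r: "0 \<le> r" "r \<le> 1" using a ab by (auto simp: r_def)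
  have "mv_norm (mv_map ?T \<nu>) / mv_norm \<nu> = r" if "blade_represents \<nu> V" for \<nu>
    using blade_norm_ratio[OF T vs that] ab a by (simp add: r_def)
  \<comment> \<open>Some blade must represent \<open>V\<close>; otherwise the condition defining the
    angle would be vacuous and would not determine it.\<close>
  moreover have "\<exists>\<nu>. blade_represents \<nu> V"
  proof (cases "vs = []")
    case True
    then have "V = {0}" using vs by (simp add: basis_list_def)
    then show ?thesis using blade_represents.scalar[of 1] by auto
  next
    case False
    then show ?thesis using blade_represents.wedge[of vs] vs wedge_nonzero
      by (auto simp: basis_list_def)
  qed
  ultimately have "grassmann_angle V W = (THE \<theta>. 0 \<le> \<theta> \<and> \<theta> \<le> pi / 2 \<and> cos \<theta> = r)"
    unfolding grassmann_angle_def by metis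
  \<comment> \<open>As \<open>r\<close> lies in [0, 1], \<open>arccos r\<close> lies in
    [0, \<open>pi / 2\<close>], and it is the only such angle with cosine \<open>r\<close>.\<close>
  also have "\<dots> = arccos r"
    using r by (intro the_equality) (auto simp del: le_divide_eq_numeral1 intro: arccos_lbound arccos_le_pi2 simp: arccos_cos)
  finally have "(cos (grassmann_angle V W))\<^sup>2 = r\<^sup>2" using r by simp
  also have "\<dots> = b / a" using a ab by (simp add: r_def)
  finally have "(cos (grassmann_angle V W))\<^sup>2 = b / a" .
  then show ?thesis using ab by simp
qed

text \<open>
  If \<open>P v\<^sub>j = \<Sum>\<^sub>i C\<^sub>i\<^sub>j w\<^sub>i\<close>, then orthogonality of \<open>v\<^sub>j - P v\<^sub>j\<close> to \<open>W\<close> gives the normal equations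
  \<open>B = A C\<close>.
\<close>

lemma gram_orth_proj:
  assumes ws: "basis_list ws W"
  shows "gram (map (orth_proj W) vs) (map (orth_proj W) vs) =
    mat_adjoint (gram ws vs) * the (mat_inverse (gram ws ws)) * gram ws vs"
proof -
  let ?A = "gram ws ws" and ?P = "map (orth_proj W) vs" and ?q = "length ws" and ?p = "length vs"
  have W: "W = span (set ws)" using ws by (simp add: basis_list_def)
  have "det ?A \<noteq> 0" using ws det_gram_nonzero by (auto simp: basis_list_def)
  note inv = mat_inverse_det_nonzero[OF gram_carrier this]
  have "set ?P \<subseteq> span (set ws)" using orth_proj_in_span by (auto simp: W)
  from exists_combs[OF this] obtain C where C: "C \<in> carrier_mat ?q ?p" "?P = combs ws C"
    unfolding length_map by blast
  have "ip w (orth_proj W v) = ip w v" if "w \<in> set ws" for w v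
    using orth_proj_orthogonal[of "set ws" w v] that by (simp add: W ip_diff_right span_base)
  \<comment> \<open>Inner products with vectors of \<open>W\<close> do not see the component of
    \<open>v\<close> orthogonal to \<open>W\<close>.\<close>
  then have "gram ws vs = gram ws ?P" by (intro eq_matI) auto
  then have B: "gram ws vs = ?A * C" using C by (simp add: gram_combs_right)
  \<comment> \<open>After substituting \<open>?A * C\<close> for \<open>gram ws vs\<close>, the
    inverse cancels against the right factor; self-adjointness of \<open>?A\<close> turns the rest
    into the Gram matrix of the projections.\<close>
  have "mat_adjoint (?A * C) * the (mat_inverse ?A) * (?A * C) =
      mat_adjoint (?A * C) * (the (mat_inverse ?A) * (?A * C))"
    using C inv by (intro assoc_mult_mat[of _ ?p ?q _ ?q _ ?p]) auto
  also have "the (mat_inverse ?A) * (?A * C) = C"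
    using C inv assoc_mult_mat[of "the (mat_inverse ?A)" ?q ?q ?A ?q C ?p] by simp
  also have "mat_adjoint (?A * C) * C = mat_adjoint C * ?A * C"
    using C by (simp add: mat_adjoint_mult mat_adjoint_gram)
  also have "\<dots> = gram ?P ?P" using C by (simp add: gram_combs)
  finally show ?thesis by (simp add: B)
qed

end

theorem theorem3p5:
  fixes scale :: "'k::real_or_complex \<Rightarrow> 'x::ab_group_add \<Rightarrow> 'x"
    and ip :: "'x \<Rightarrow> 'x \<Rightarrow> 'k"
    and vs ws :: "'x list" and V W :: "'x set" and p q :: nat
    and A B D :: "'k mat"
  assumes "finite_dim_inner_product_space scale ip"
    and "length vs = p" and "finite_dim_inner_product_space.basis_list scale vs V"
    and "length ws = q" and "finite_dim_inner_product_space.basis_list scale ws W"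
    and "A = mat q q (\<lambda>(i, j). ip (ws ! i) (ws ! j))"
    and "B = mat q p (\<lambda>(i, j). ip (ws ! i) (vs ! j))"
    and "D = mat p p (\<lambda>(i, j). ip (vs ! i) (vs ! j))"
  shows "of_real ((cos (finite_dim_inner_product_space.grassmann_angle scale ip V W))\<^sup>2) =
    det (mat_adjoint B * the (mat_inverse A) * B) / det D"
proof -
  interpret finite_dim_inner_product_space scale ip by fact
  have "W = span (set ws)" using assms(5) by (simp add: basis_list_def)
  moreover have "A = gram ws ws" "B = gram ws vs" "D = gram vs vs"
    using assms by (simp_all add: gram_def)
  ultimately show ?thesis
    using cos_grassmann_angle[OF assms(3), of W "set ws"] gram_orth_proj[OF assms(5), of vs]
    by simp
qed

end
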